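(* Let $\Phi$ be a set of CHCs over $\Sigma_{BV}\cup\Pi$, let $\Delta_{BV}\subseteq\Phi$ and $\Delta_{IA}=\Phi\setminus\Delta_{BV}$, and let $E=(\Phi_{BV},\Phi_{IA},I)$ be the theory-modular encoding of $\Phi$ induced by $(\Delta_{BV},\Delta_{IA})$ (with respect to fixed domain transformers and a fixed theory transformer $\tau_{BV\to IA}$). Then $\Phi$ is satisfiable modulo $T_{BV}$ if and only if $E$ is satisfiable modulo $(T_{BV},T_{IA})$.
   Context: **Theories.** $\Sigma_{BV}$ is the many-sorted first-order signature of SMT-LIB fixed-size bit-vectors: a sort $BV_n$ for each $n\ge 1$; predicates: equality, unsigned and signed comparisons; functions: a constant for every bit-vector, and the usual arithmetic, bitwise, shift, extraction and concatenation operators. $\Sigma_{IA}$ is the signature of integer arithmetic: one sort $Int$, predicates $=,<,\le$, a constant for every integer, and $+,-,\cdot,\mathrm{div},\mathrm{mod}$. $T_{BV}$ and $T_{IA}$ are the corresponding SMT-LIB theories, with fixed standard models $M_{BV}$ (the domain of $BV_n$ is the finite set of all bit-vectors of width $n$) and $M_{IA}$ (domain $\mathbb{Z}$). Satisfiability and validity modulo $T_{BV}$ (resp. $T_{IA}$) are understood with respect to $M_{BV}$ (resp. $M_{IA}$). $QF_{BV}$, $QF_{IA}$ are the classes of quantifier-free formulas over $\Sigma_{BV}$, $\Sigma_{IA}$. For a formula $\varphi$ with free variables $\bar x$ and a structure $M$, $[\![\varphi]\!]_M$ is the set of value tuples for $\bar x$ satisfying $\varphi$ in $M$. For a predicate $p$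 or a tuple of variables $\bar x$, $D_p$, $D_{\bar x}$ denote the product of the domains of the corresponding bit-vector sorts in $M_{BV}$. **CHCs.** Let $\Pi$ be a set of fresh (uninterpreted) predicate symbols typed over the sorts of a signature $\Sigma$. A CHC over $\Sigma\cup\Pi$ is a sentence $\forall\bar x.\ (\phi[\bar x]\wedge\bigwedge_j p_j(\bar x_{p_j}))\to H$, where $\phi$ is a quantifier-free $\Sigma$-formula (the constraint) in which all variables of $\bar x$ appear, $p_j\in\Pi$ (repetitions allowed), $\bar x_{p_j}\subseteq\bar x$, and the head $H$ is either $h(\bar x_h)$ with $h\in\Pi$, $\bar x_h\subseteq\bar x$ (a rule), or $\bot$ (a query). The left-hand side is the body. **Semantics of a CHC set.** For a set $\Phi$ of CHCs over $\Sigma_{BV}\cup\Pi$, $p\in\Pi$, $n\in\mathbb{N}$, the bounded semantics $[\![p]\!]_{M_{BV}}^n$ is the union, over all rules $\forall\bar x.\,B[\bar x]\to p(\bar x_p)$ in $\Phi$, of the set of values of $\bar x_p$ under assignments satisfying $B$ in the expansion of $M_{BV}$ that interprets every $q\in\Pi$ as $\emptyset$ if $n=0$ and as $[\![q]\!]_{M_{BV}}^{n-1}$ if $n>0$. Set $[\![p]\!]_{M_{BV}}=\bigcup_n[\![p]\!]_{M_{BV}}^n$. $\Phi$ is satisfiable modulo $T_{BV}$ if every query of $\Phi$ is true in the expansion of $M_{BV}$ interpreting each $p\in\Pi$ as $[\![p]\!]_{M_{BV}}$. **Transformers.** A fixed bijection $x\mapsto x'$ maps bit-vector variables to integer variables.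 Each bit-vector variable $x$ of sort $BV_n$ has a domain transformer $\delta_x$, an injective map from the set of bit-vectors of width $n$ to $\mathbb{Z}$; it is required that all variables appearing in the same argument position of an uninterpreted predicate in $\Phi$ have the same domain transformer. $\delta_{\bar x}$ acts componentwise on tuples and elementwise on sets; $\delta_p=\delta_{\bar x_p}$ for any application $p(\bar x_p)$ in $\Phi$; $\delta^{-1}$ denotes preimage. $\rho(x')$ is the $\Sigma_{IA}$-constraint (domain restriction) expressing that $x'$ lies in the image of $\delta_x$. A theory transformer from $T_{BV}$ to $T_{IA}$ is a function $\tau_{BV\to IA}$ mapping every $\varphi\in QF_{BV}$ with free variables $\bar x$ to some $\tau_{BV\to IA}(\varphi)\in QF_{IA}$ with free variables $\bar x'$ such that $[\![\varphi]\!]_{M_{BV}}=\delta_{\bar x}^{-1}\big([\![\tau_{BV\to IA}(\varphi)]\!]_{M_{IA}}\cap\delta_{\bar x}(D_{\bar x})\big)$. **Theory-modular encoding.** Given $\Delta_{BV}\subseteq\Phi$, $\Delta_{IA}=\Phi\setminus\Delta_{BV}$, the encoding is $E=(\Phi_{BV},\Phi_{IA},I)$, where, with fresh copies $\Pi^{BV}=\{p^{BV}:p\in\Pi\}$ (same types) and $\Pi^{IA}=\{p^{IA}:p\in\Pi\}$ (all arguments of sort $Int$): - $\Phi_{BV}$ is obtained from $\Delta_{BV}$ by replacing each $p$ by $p^{BV}$. - $\Phi_{IA}$ is obtained from $\Delta_{IA}$ by replacing each CHC $\forall\bar x.\,(\phi\wedge\bigwedge_j p_j(\bar x_{p_j}))\to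 h(\bar x_h)$ by $\forall\bar x'.\,(\tau_{BV\to IA}(\phi)\wedge\bigwedge_j p_j^{IA}(\bar x'_{p_j})\wedge\bigwedge_{x\in\bar y}\rho(x'))\to h^{IA}(\bar x'_h)$, where $\bar y=\bar x\setminus\bigcup_j\bar x_{p_j}$; a head $\bot$ is left unchanged. - $I=I_{BV}\cup I_{IA}$: $I_{BV}$ consists of all pairs $(p^{BV},p^{IA})$ such that $p^{BV}$ is the head predicate of some CHC in $\Phi_{BV}$ and $p^{IA}$ occurs in the body of some CHC in $\Phi_{IA}$; $I_{IA}$ consists of all pairs $(p^{IA},p^{BV})$ such that $p^{IA}$ is the head predicate of some CHC in $\Phi_{IA}$ and $p^{BV}$ occurs in the body of some CHC in $\Phi_{BV}$. **Semantics of the encoding.** For $\{a,b\}=\{BV,IA\}$, $p^a\in\Pi^a$ and $n\in\mathbb{N}$, define by induction on $n$: $[\![p^a]\!]^n=L^n(p^a)\cup X^n(p^a)$. The local part $L^n(p^a)$ is the union, over all rules $\forall\bar x.\,B\to p^a(\bar x_{p^a})$ in $\Phi_a$, of the set of values of $\bar x_{p^a}$ under assignments satisfying $B$ in the expansion of $M_a$ interpreting every $q^a\in\Pi^a$ as $\emptyset$ if $n=0$ and as $[\![q^a]\!]^{n-1}$ if $n>0$. The external part $X^n(p^a)$ is $\emptyset$ if $n=0$ or $(p^b,p^a)\notin I$; otherwise it is $\delta_p([\![p^{BV}]\!]^{n-1})$ if $a=IA$, and $\delta_p^{-1}([\![p^{IA}]\!]^{n-1})$ if $a=BV$. Set $[\![p^a]\!]=\bigcup_n[\![p^a]\!]^n$.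 $E$ is satisfiable modulo $(T_{BV},T_{IA})$ if for each $a\in\{BV,IA\}$, every query in $\Phi_a$ is true in the expansion of $M_a$ interpreting each $p^a\in\Pi^a$ as $[\![p^a]\!]$. *)

theory Defs
  imports Main
begin

section \<open>Quantifier-free formulas\<close>

datatype (atoms: 'a) qf =
    Atom 'a
  | Truth
  | Falsity
  | Neg "'a qf"
  | Conj "'a qf" "'a qf"
  | Disj "'a qf" "'a qf"
  | Impl "'a qf" "'a qf"
  | Equiv "'a qf" "'a qf"

primrec qf_holds :: "('a \<Rightarrow> bool) \<Rightarrow> 'a qf \<Rightarrow> bool" where
  "qf_holds I (Atom a) = I a"
| "qf_holds I Truth = True"
| "qf_holds I Falsity = False"
| "qf_holds I (Neg \<phi>) = (\<not> qf_holds I \<phi>)"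
| "qf_holds I (Conj \<phi> \<psi>) = (qf_holds I \<phi> \<and> qf_holds I \<psi>)"
| "qf_holds I (Disj \<phi> \<psi>) = (qf_holds I \<phi> \<or> qf_holds I \<psi>)"
| "qf_holds I (Impl \<phi> \<psi>) = (qf_holds I \<phi> \<longrightarrow> qf_holds I \<psi>)"
| "qf_holds I (Equiv \<phi> \<psi>) = (qf_holds I \<phi> \<longleftrightarrow> qf_holds I \<psi>)"


section \<open>Fixed-size bit-vectors\<close>

text \<open>
  A bit-vector of width \<open>n\<close> is a list of \<open>n\<close> bits, least significant bit first. Widths are
  terms, not types, because a single formula or clause set mixes arbitrarily many of them.
\<close>

type_synonym bits = "bool list"

definition bv_dom :: "nat \<Rightarrow> bits set" where
  "bv_dom n = {b. length b = n}"

definition uval :: "bits \<Rightarrow> int" where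
  "uval b = horner_sum of_bool 2 b"

definition sval :: "bits \<Rightarrow> int" where
  "sval b = uval b - (if last b then 2 ^ length b else 0)"

text \<open>The width-\<open>n\<close> bit-vector congruent to \<open>k\<close> modulo \<open>2 ^ n\<close>; \<open>k\<close> may be negative.\<close>

definition to_bits :: "nat \<Rightarrow> int \<Rightarrow> bits" where
  "to_bits n k = map (bit k) [0..<n]"

datatype bv_unop = BVNot | BVNeg

datatype bv_binop =
    BVAnd | BVOr | BVXor | BVNand | BVNor | BVXnor
  | BVAdd | BVSub | BVMul
  | BVUdiv | BVUrem | BVSdiv | BVSrem | BVSmod
  | BVShl | BVLshr | BVAshr

text \<open>
  The following equations are those of the SMT-LIB theory \<open>FixedSizeBitVectors\<close> and the logic
  \<open>QF_BV\<close>. In particular, unsigned division by zero returns the all-ones vector and the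
  unsigned remainder by zero returns the dividend; the signed operators are reduced to the
  unsigned ones by case distinction on the sign bits.
\<close>

definition bv_not :: "bits \<Rightarrow> bits" where
  "bv_not s = map Not s"

definition bv_neg :: "bits \<Rightarrow> bits" where
  "bv_neg s = to_bits (length s) (- uval s)"

definition bv_udiv :: "bits \<Rightarrow> bits \<Rightarrow> bits" where
  "bv_udiv s t =
     (if uval t = 0 then replicate (length s) True else to_bits (length s) (uval s div uval t))"

definition bv_urem :: "bits \<Rightarrow> bits \<Rightarrow> bits" where
  "bv_urem s t = (if uval t = 0 then s else to_bits (length s) (uval s mod uval t))"

definition bv_sdiv :: "bits \<Rightarrow> bits \<Rightarrow> bits" where
  "bv_sdiv s t =
     (if \<not> last s \<and> \<not> last t then bv_udiv s t
      else if last s \<and> \<not> last t then bv_neg (bv_udiv (bv_neg s) t)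
      else if \<not> last s \<and> last t then bv_neg (bv_udiv s (bv_neg t))
      else bv_udiv (bv_neg s) (bv_neg t))"

definition bv_srem :: "bits \<Rightarrow> bits \<Rightarrow> bits" where
  "bv_srem s t =
     (if \<not> last s \<and> \<not> last t then bv_urem s t
      else if last s \<and> \<not> last t then bv_neg (bv_urem (bv_neg s) t)
      else if \<not> last s \<and> last t then bv_urem s (bv_neg t)
      else bv_neg (bv_urem (bv_neg s) (bv_neg t)))"

definition bv_add :: "bits \<Rightarrow> bits \<Rightarrow> bits" where
  "bv_add s t = to_bits (length s) (uval s + uval t)"

definition bv_smod :: "bits \<Rightarrow> bits \<Rightarrow> bits" where
  "bv_smod s t =
     (let u = bv_urem (if last s then bv_neg s else s) (if last t then bv_neg t else t)
      in if uval u = 0 then u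
         else if \<not> last s \<and> \<not> last t then u
         else if last s \<and> \<not> last t then bv_add (bv_neg u) t
         else if \<not> last s \<and> last t then bv_add u t
         else bv_neg u)"

definition bv_lshr :: "bits \<Rightarrow> bits \<Rightarrow> bits" where
  "bv_lshr s t = to_bits (length s) (uval s div 2 ^ nat (uval t))"

fun bv_unop_eval :: "bv_unop \<Rightarrow> bits \<Rightarrow> bits" where
  "bv_unop_eval BVNot s = bv_not s"
| "bv_unop_eval BVNeg s = bv_neg s"

fun bv_binop_eval :: "bv_binop \<Rightarrow> bits \<Rightarrow> bits \<Rightarrow> bits" where
  "bv_binop_eval BVAnd s t = map2 (\<and>) s t"
| "bv_binop_eval BVOr s t = map2 (\<or>) s t"
| "bv_binop_eval BVXor s t = map2 (\<noteq>) s t"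
| "bv_binop_eval BVNand s t = bv_not (map2 (\<and>) s t)"
| "bv_binop_eval BVNor s t = bv_not (map2 (\<or>) s t)"
| "bv_binop_eval BVXnor s t = map2 (=) s t"
| "bv_binop_eval BVAdd s t = bv_add s t"
| "bv_binop_eval BVSub s t = to_bits (length s) (uval s - uval t)"
| "bv_binop_eval BVMul s t = to_bits (length s) (uval s * uval t)"
| "bv_binop_eval BVUdiv s t = bv_udiv s t"
| "bv_binop_eval BVUrem s t = bv_urem s t"
| "bv_binop_eval BVSdiv s t = bv_sdiv s t"
| "bv_binop_eval BVSrem s t = bv_srem s t"
| "bv_binop_eval BVSmod s t = bv_smod s t"
| "bv_binop_eval BVShl s t = to_bits (length s) (uval s * 2 ^ nat (uval t))"
| "bv_binop_eval BVLshr s t = bv_lshr s t"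
| "bv_binop_eval BVAshr s t = (if last s then bv_not (bv_lshr (bv_not s) t) else bv_lshr s t)"

datatype (bv_term_vars: 'v) bv_term =
    BVVar 'v
  | BVConst bits
  | BVUnop bv_unop "'v bv_term"
  | BVBinop bv_binop "'v bv_term" "'v bv_term"
  | BVComp "'v bv_term" "'v bv_term"
  | BVConcat "'v bv_term" "'v bv_term"
  | BVExtract nat nat "'v bv_term"
  | BVRepeat nat "'v bv_term"
  | BVZeroExtend nat "'v bv_term"
  | BVSignExtend nat "'v bv_term"
  | BVRotateLeft nat "'v bv_term"
  | BVRotateRight nat "'v bv_term"

text \<open>
  \<open>BVConcat s t\<close> has \<open>s\<close> as its high part, and \<open>BVExtract i j t\<close> selects the bits \<open>i\<close> down
  to \<open>j\<close>, as in SMT-LIB. With the least significant bit at the head of the list, the library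
  function \<^const>\<open>rotate\<close> is a rotation to the right.
\<close>

primrec bv_eval :: "('v \<Rightarrow> bits) \<Rightarrow> 'v bv_term \<Rightarrow> bits" where
  "bv_eval \<nu> (BVVar x) = \<nu> x"
| "bv_eval \<nu> (BVConst b) = b"
| "bv_eval \<nu> (BVUnop f t) = bv_unop_eval f (bv_eval \<nu> t)"
| "bv_eval \<nu> (BVBinop f s t) = bv_binop_eval f (bv_eval \<nu> s) (bv_eval \<nu> t)"
| "bv_eval \<nu> (BVComp s t) = [bv_eval \<nu> s = bv_eval \<nu> t]"
| "bv_eval \<nu> (BVConcat s t) = bv_eval \<nu> t @ bv_eval \<nu> s"
| "bv_eval \<nu> (BVExtract i j t) = take (i + 1 - j) (drop j (bv_eval \<nu> t))"
| "bv_eval \<nu> (BVRepeat k t) = concat (replicate k (bv_eval \<nu> t))"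
| "bv_eval \<nu> (BVZeroExtend k t) = bv_eval \<nu> t @ replicate k False"
| "bv_eval \<nu> (BVSignExtend k t) = bv_eval \<nu> t @ replicate k (last (bv_eval \<nu> t))"
| "bv_eval \<nu> (BVRotateLeft k t) = rev (rotate k (rev (bv_eval \<nu> t)))"
| "bv_eval \<nu> (BVRotateRight k t) = rotate k (bv_eval \<nu> t)"

text \<open>\<open>bv_sort w t n\<close>: the term \<open>t\<close> is well-sorted and of width \<open>n\<close>, where the
  variable \<open>x\<close> has width \<open>w x\<close>.\<close>

inductive bv_sort :: "('v \<Rightarrow> nat) \<Rightarrow> 'v bv_term \<Rightarrow> nat \<Rightarrow> bool" for w where
  "bv_sort w (BVVar x) (w x)"
| "1 \<le> length b \<Longrightarrow> bv_sort w (BVConst b) (length b)"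
| "bv_sort w t n \<Longrightarrow> bv_sort w (BVUnop f t) n"
| "bv_sort w s n \<Longrightarrow> bv_sort w t n \<Longrightarrow> bv_sort w (BVBinop f s t) n"
| "bv_sort w s n \<Longrightarrow> bv_sort w t n \<Longrightarrow> bv_sort w (BVComp s t) 1"
| "bv_sort w s m \<Longrightarrow> bv_sort w t n \<Longrightarrow> bv_sort w (BVConcat s t) (m + n)"
| "bv_sort w t n \<Longrightarrow> j \<le> i \<Longrightarrow> i < n \<Longrightarrow> bv_sort w (BVExtract i j t) (i + 1 - j)"
| "bv_sort w t n \<Longrightarrow> 1 \<le> k \<Longrightarrow> bv_sort w (BVRepeat k t) (k * n)"
| "bv_sort w t n \<Longrightarrow> bv_sort w (BVZeroExtend k t) (n + k)"
| "bv_sort w t n \<Longrightarrow> bv_sort w (BVSignExtend k t) (n + k)"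
| "bv_sort w t n \<Longrightarrow> bv_sort w (BVRotateLeft k t) n"
| "bv_sort w t n \<Longrightarrow> bv_sort w (BVRotateRight k t) n"

datatype bv_pred =
  BVEq | BVUlt | BVUle | BVUgt | BVUge | BVSlt | BVSle | BVSgt | BVSge

fun bv_pred_holds :: "bv_pred \<Rightarrow> bits \<Rightarrow> bits \<Rightarrow> bool" where
  "bv_pred_holds BVEq s t = (s = t)"
| "bv_pred_holds BVUlt s t = (uval s < uval t)"
| "bv_pred_holds BVUle s t = (uval s \<le> uval t)"
| "bv_pred_holds BVUgt s t = (uval s > uval t)"
| "bv_pred_holds BVUge s t = (uval s \<ge> uval t)"
| "bv_pred_holds BVSlt s t = (sval s < sval t)"
| "bv_pred_holds BVSle s t = (sval s \<le> sval t)"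
| "bv_pred_holds BVSgt s t = (sval s > sval t)"
| "bv_pred_holds BVSge s t = (sval s \<ge> sval t)"

datatype (bv_atom_vars: 'v) bv_atom = BVAtom bv_pred "'v bv_term" "'v bv_term"

type_synonym 'v bv_fm = "'v bv_atom qf"

primrec bv_atom_holds :: "('v \<Rightarrow> bits) \<Rightarrow> 'v bv_atom \<Rightarrow> bool" where
  "bv_atom_holds \<nu> (BVAtom r s t) = bv_pred_holds r (bv_eval \<nu> s) (bv_eval \<nu> t)"

primrec bv_atom_wf :: "('v \<Rightarrow> nat) \<Rightarrow> 'v bv_atom \<Rightarrow> bool" where
  "bv_atom_wf w (BVAtom r s t) = (\<exists>n. bv_sort w s n \<and> bv_sort w t n)"

definition bv_fv :: "'v bv_fm \<Rightarrow> 'v set" where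
  "bv_fv \<phi> = (\<Union>a\<in>atoms \<phi>. bv_atom_vars a)"

definition QF_BV :: "('v \<Rightarrow> nat) \<Rightarrow> 'v bv_fm set" where
  "QF_BV w = {\<phi>. \<forall>a\<in>atoms \<phi>. bv_atom_wf w a}"


section \<open>Integer arithmetic\<close>

datatype (ia_term_vars: 'u) ia_term =
    IAVar 'u
  | IAConst int
  | IAAdd "'u ia_term" "'u ia_term"
  | IASub "'u ia_term" "'u ia_term"
  | IAMul "'u ia_term" "'u ia_term"
  | IADiv "'u ia_term" "'u ia_term"
  | IAMod "'u ia_term" "'u ia_term"

text \<open>
  SMT-LIB integer division is Euclidean: the remainder is non-negative also for negative
  divisors, unlike that of \<^const>\<open>modulo\<close> on \<^typ>\<open>int\<close>. The values of \<open>div\<close> and \<open>mod\<close> at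
  divisor zero are left open by SMT-LIB; a standard model fixes them by two functions
  \<open>d0\<close> and \<open>m0\<close> of the dividend.
\<close>

definition smt_div :: "(int \<Rightarrow> int) \<Rightarrow> int \<Rightarrow> int \<Rightarrow> int" where
  "smt_div d0 m n = (if n = 0 then d0 m else sgn n * (m div \<bar>n\<bar>))"

definition smt_mod :: "(int \<Rightarrow> int) \<Rightarrow> int \<Rightarrow> int \<Rightarrow> int" where
  "smt_mod m0 m n = (if n = 0 then m0 m else m mod \<bar>n\<bar>)"

primrec ia_eval ::
    "(int \<Rightarrow> int) \<Rightarrow> (int \<Rightarrow> int) \<Rightarrow> ('u \<Rightarrow> int) \<Rightarrow> 'u ia_term \<Rightarrow> int" where
  "ia_eval d0 m0 \<mu> (IAVar x) = \<mu> x"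
| "ia_eval d0 m0 \<mu> (IAConst k) = k"
| "ia_eval d0 m0 \<mu> (IAAdd s t) = ia_eval d0 m0 \<mu> s + ia_eval d0 m0 \<mu> t"
| "ia_eval d0 m0 \<mu> (IASub s t) = ia_eval d0 m0 \<mu> s - ia_eval d0 m0 \<mu> t"
| "ia_eval d0 m0 \<mu> (IAMul s t) = ia_eval d0 m0 \<mu> s * ia_eval d0 m0 \<mu> t"
| "ia_eval d0 m0 \<mu> (IADiv s t) = smt_div d0 (ia_eval d0 m0 \<mu> s) (ia_eval d0 m0 \<mu> t)"
| "ia_eval d0 m0 \<mu> (IAMod s t) = smt_mod m0 (ia_eval d0 m0 \<mu> s) (ia_eval d0 m0 \<mu> t)"

datatype ia_pred = IAEq | IALt | IALe

fun ia_pred_holds :: "ia_pred \<Rightarrow> int \<Rightarrow> int \<Rightarrow> bool" where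
  "ia_pred_holds IAEq k l = (k = l)"
| "ia_pred_holds IALt k l = (k < l)"
| "ia_pred_holds IALe k l = (k \<le> l)"

datatype (ia_atom_vars: 'u) ia_atom = IAAtom ia_pred "'u ia_term" "'u ia_term"

text \<open>There is only one integer sort, so every formula of this type is in \<open>QF_IA\<close>.\<close>

type_synonym 'u ia_fm = "'u ia_atom qf"

primrec ia_atom_holds ::
    "(int \<Rightarrow> int) \<Rightarrow> (int \<Rightarrow> int) \<Rightarrow> ('u \<Rightarrow> int) \<Rightarrow> 'u ia_atom \<Rightarrow> bool" where
  "ia_atom_holds d0 m0 \<mu> (IAAtom r s t) =
     ia_pred_holds r (ia_eval d0 m0 \<mu> s) (ia_eval d0 m0 \<mu> t)"

definition ia_fv :: "'u ia_fm \<Rightarrow> 'u set" where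
  "ia_fv \<psi> = (\<Union>a\<in>atoms \<psi>. ia_atom_vars a)"


section \<open>Standard models\<close>

text \<open>
  A model is represented by its sort-respecting variable assignments and its satisfaction
  relation for constraints (\<open>'f\<close>: constraints, \<open>'v\<close>: variables, \<open>'d\<close>: values).
\<close>

record ('f, 'v, 'd) model =
  assigns :: "('v \<Rightarrow> 'd) set"
  holds :: "('v \<Rightarrow> 'd) \<Rightarrow> 'f \<Rightarrow> bool"

definition M_BV :: "('v \<Rightarrow> nat) \<Rightarrow> ('v bv_fm, 'v, bits) model" where
  "M_BV w = \<lparr>assigns = {\<nu>. \<forall>x. \<nu> x \<in> bv_dom (w x)}, holds = (\<lambda>\<nu>. qf_holds (bv_atom_holds \<nu>))\<rparr>"

definition M_IA :: "(int \<Rightarrow> int) \<Rightarrow> (int \<Rightarrow> int) \<Rightarrow> ('u ia_fm, 'u, int) model" where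
  "M_IA d0 m0 = \<lparr>assigns = UNIV, holds = (\<lambda>\<mu>. qf_holds (ia_atom_holds d0 m0 \<mu>))\<rparr>"

definition solutions :: "('f, 'v, 'd) model \<Rightarrow> 'f \<Rightarrow> 'v list \<Rightarrow> 'd list set" where
  "solutions M \<phi> xs = {map \<nu> xs |\<nu>. \<nu> \<in> assigns M \<and> holds M \<nu> \<phi>}"


section \<open>Constrained Horn clauses\<close>

text \<open>
  \<open>CHC xs \<phi> B H\<close> is the sentence \<open>\<forall>xs. \<phi> \<and> \<And>B \<longrightarrow> H\<close>; the head \<open>None\<close> stands for falsity.
\<close>

datatype ('f, 'v, 'p) chc =
  CHC (qvars: "'v list") (constr: 'f) (body: "('p \<times> 'v list) list") (head: "('p \<times> 'v list) option")

definition applications :: "('f, 'v, 'p) chc set \<Rightarrow> ('p \<times> 'v list) set" where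
  "applications \<Phi> = (\<Union>c\<in>\<Phi>. set (body c) \<union> set_option (head c))"

text \<open>\<open>ty p\<close> lists the widths of the argument sorts of the uninterpreted predicate \<open>p\<close>.\<close>

definition wf_bv_chc ::
    "('v \<Rightarrow> nat) \<Rightarrow> ('p \<Rightarrow> nat list) \<Rightarrow> ('v bv_fm, 'v, 'p) chc \<Rightarrow> bool" where
  "wf_bv_chc w ty c \<longleftrightarrow>
     constr c \<in> QF_BV w \<and>
     distinct (qvars c) \<and> set (qvars c) = bv_fv (constr c) \<and>
     (\<forall>(p, xs) \<in> applications {c}. set xs \<subseteq> set (qvars c) \<and> map w xs = ty p)"

text \<open>Truth of a clause body in the expansion of \<open>M\<close> that interprets each \<open>p\<close> as \<open>J p\<close>.\<close>

definition body_holds ::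
    "('f, 'v, 'd) model \<Rightarrow> ('p \<Rightarrow> 'd list set) \<Rightarrow> ('v \<Rightarrow> 'd) \<Rightarrow> ('f, 'v, 'p) chc \<Rightarrow> bool" where
  "body_holds M J \<nu> c \<longleftrightarrow> holds M \<nu> (constr c) \<and> (\<forall>(p, xs) \<in> set (body c). map \<nu> xs \<in> J p)"

definition rule_step ::
    "('f, 'v, 'd) model \<Rightarrow> ('f, 'v, 'p) chc set \<Rightarrow> ('p \<Rightarrow> 'd list set) \<Rightarrow> 'p \<Rightarrow> 'd list set" where
  "rule_step M \<Phi> J p =
     (\<Union>c\<in>\<Phi>. {map \<nu> xs |\<nu> xs. head c = Some (p, xs) \<and> \<nu> \<in> assigns M \<and> body_holds M J \<nu> c})"

definition queries_true ::
    "('f, 'v, 'd) model \<Rightarrow> ('f, 'v, 'p) chc set \<Rightarrow> ('p \<Rightarrow> 'd list set) \<Rightarrow> bool" where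
  "queries_true M \<Phi> J \<longleftrightarrow>
     (\<forall>c\<in>\<Phi>. head c = None \<longrightarrow> (\<forall>\<nu>\<in>assigns M. \<not> body_holds M J \<nu> c))"

primrec bounded_sem ::
    "('f, 'v, 'd) model \<Rightarrow> ('f, 'v, 'p) chc set \<Rightarrow> nat \<Rightarrow> 'p \<Rightarrow> 'd list set" where
  "bounded_sem M \<Phi> 0 = rule_step M \<Phi> (\<lambda>_. {})"
| "bounded_sem M \<Phi> (Suc n) = rule_step M \<Phi> (bounded_sem M \<Phi> n)"

definition chc_sem :: "('f, 'v, 'd) model \<Rightarrow> ('f, 'v, 'p) chc set \<Rightarrow> 'p \<Rightarrow> 'd list set" where
  "chc_sem M \<Phi> p = (\<Union>n. bounded_sem M \<Phi> n p)"

definition chc_satisfiable :: "('f, 'v, 'd) model \<Rightarrow> ('f, 'v, 'p) chc set \<Rightarrow> bool" where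
  "chc_satisfiable M \<Phi> \<longleftrightarrow> queries_true M \<Phi> (chc_sem M \<Phi>)"


section \<open>Domain and theory transformers\<close>

text \<open>
  Each \<open>\<delta> x\<close> is only meaningful on \<open>bv_dom (w x)\<close>, so two variables have the same transformer
  if theirs agree on that domain (variables in the same argument position have equal width).
\<close>

definition domain_transformers ::
    "('v \<Rightarrow> nat) \<Rightarrow> ('f, 'v, 'p) chc set \<Rightarrow> ('v \<Rightarrow> bits \<Rightarrow> int) \<Rightarrow> bool" where
  "domain_transformers w \<Phi> \<delta> \<longleftrightarrow>
     (\<forall>x. inj_on (\<delta> x) (bv_dom (w x))) \<and>
     (\<forall>p xs ys i. (p, xs) \<in> applications \<Phi> \<longrightarrow> (p, ys) \<in> applications \<Phi> \<longrightarrow>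
        i < length xs \<longrightarrow> i < length ys \<longrightarrow>
        (\<forall>b\<in>bv_dom (w (xs ! i)). \<delta> (xs ! i) b = \<delta> (ys ! i) b))"

definition tuple_dom :: "nat list \<Rightarrow> bits list set" where
  "tuple_dom ns = {bs. list_all2 (\<lambda>b n. b \<in> bv_dom n) bs ns}"

definition tuple_transformer :: "('v \<Rightarrow> bits \<Rightarrow> int) \<Rightarrow> 'v list \<Rightarrow> bits list \<Rightarrow> int list" where
  "tuple_transformer \<delta> xs bs = map2 \<delta> xs bs"

text \<open>
  The transformer of a predicate is that of the argument tuple of any of its applications in
  \<open>\<Phi>\<close>; by the uniformity condition in \<^const>\<open>domain_transformers\<close> the choice does not matter.
  For a predicate that does not occur in \<open>\<Phi>\<close> the value is unspecified and never used.
\<close>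

definition pred_transformer ::
    "('v \<Rightarrow> bits \<Rightarrow> int) \<Rightarrow> ('f, 'v, 'p) chc set \<Rightarrow> 'p \<Rightarrow> bits list \<Rightarrow> int list" where
  "pred_transformer \<delta> \<Phi> p = tuple_transformer \<delta> (SOME xs. (p, xs) \<in> applications \<Phi>)"

text \<open>
  Below, \<open>pr\<close> is the bijection from bit-vector variables to integer variables, and \<open>\<rho> (pr x)\<close>
  is the domain restriction of \<open>pr x\<close>.
\<close>

definition domain_restriction ::
    "('v \<Rightarrow> nat) \<Rightarrow> ('u ia_fm, 'u, int) model \<Rightarrow> ('v \<Rightarrow> 'u) \<Rightarrow> ('v \<Rightarrow> bits \<Rightarrow> int) \<Rightarrow>
     ('u \<Rightarrow> 'u ia_fm) \<Rightarrow> bool" where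
  "domain_restriction w MIA pr \<delta> \<rho> \<longleftrightarrow>
     (\<forall>x. ia_fv (\<rho> (pr x)) = {pr x} \<and>
        (\<forall>\<mu>\<in>assigns MIA. holds MIA \<mu> (\<rho> (pr x)) \<longleftrightarrow> \<mu> (pr x) \<in> \<delta> x ` bv_dom (w x)))"

definition theory_transformer ::
    "('v \<Rightarrow> nat) \<Rightarrow> ('u ia_fm, 'u, int) model \<Rightarrow> ('v \<Rightarrow> 'u) \<Rightarrow> ('v \<Rightarrow> bits \<Rightarrow> int) \<Rightarrow>
     ('v bv_fm \<Rightarrow> 'u ia_fm) \<Rightarrow> bool" where
  "theory_transformer w MIA pr \<delta> \<tau> \<longleftrightarrow>
     (\<forall>\<phi>\<in>QF_BV w. ia_fv (\<tau> \<phi>) = pr ` bv_fv \<phi> \<and>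
        (\<forall>xs. distinct xs \<longrightarrow> set xs = bv_fv \<phi> \<longrightarrow>
           solutions (M_BV w) \<phi> xs =
           {bs \<in> tuple_dom (map w xs).
              tuple_transformer \<delta> xs bs \<in>
                solutions MIA (\<tau> \<phi>) (map pr xs) \<inter>
                tuple_transformer \<delta> xs ` tuple_dom (map w xs)}))"


section \<open>Theory-modular encoding\<close>

datatype 'p bv_copy = PBV 'p
datatype 'p ia_copy = PIA 'p

fun bv_clause :: "('f, 'v, 'p) chc \<Rightarrow> ('f, 'v, 'p bv_copy) chc" where
  "bv_clause (CHC xs \<phi> B H) =
     CHC xs \<phi> (map (map_prod PBV id) B) (map_option (map_prod PBV id) H)"

text \<open>The conjuncts \<open>\<rho> (pr x)\<close> are made part of the constraint of the resulting clause.\<close>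

fun ia_clause ::
    "('v \<Rightarrow> 'u) \<Rightarrow> ('f \<Rightarrow> 'u ia_fm) \<Rightarrow> ('u \<Rightarrow> 'u ia_fm) \<Rightarrow>
     ('f, 'v, 'p) chc \<Rightarrow> ('u ia_fm, 'u, 'p ia_copy) chc" where
  "ia_clause pr \<tau> \<rho> (CHC xs \<phi> B H) =
     (let ys = filter (\<lambda>x. x \<notin> (\<Union>(p, zs) \<in> set B. set zs)) xs
      in CHC (map pr xs)
           (foldl Conj (\<tau> \<phi>) (map (\<lambda>x. \<rho> (pr x)) ys))
           (map (map_prod PIA (map pr)) B)
           (map_option (map_prod PIA (map pr)) H))"

definition head_preds :: "('f, 'v, 'p) chc set \<Rightarrow> 'p set" where
  "head_preds \<Phi> = {p. \<exists>c\<in>\<Phi>. \<exists>xs. head c = Some (p, xs)}"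

definition body_preds :: "('f, 'v, 'p) chc set \<Rightarrow> 'p set" where
  "body_preds \<Phi> = {p. \<exists>c\<in>\<Phi>. \<exists>xs. (p, xs) \<in> set (body c)}"

record ('v, 'u, 'p) encoding =
  clauses_BV :: "('v bv_fm, 'v, 'p bv_copy) chc set"
  clauses_IA :: "('u ia_fm, 'u, 'p ia_copy) chc set"
  interface :: "(('p bv_copy + 'p ia_copy) \<times> ('p bv_copy + 'p ia_copy)) set"

definition interface_BV ::
    "('f, 'v, 'p bv_copy) chc set \<Rightarrow> ('g, 'u, 'p ia_copy) chc set \<Rightarrow>
     (('p bv_copy + 'p ia_copy) \<times> ('p bv_copy + 'p ia_copy)) set" where
  "interface_BV \<Phi>BV \<Phi>IA =
     {(Inl (PBV p), Inr (PIA p)) |p. PBV p \<in> head_preds \<Phi>BV \<and> PIA p \<in> body_preds \<Phi>IA}"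

definition interface_IA ::
    "('f, 'v, 'p bv_copy) chc set \<Rightarrow> ('g, 'u, 'p ia_copy) chc set \<Rightarrow>
     (('p bv_copy + 'p ia_copy) \<times> ('p bv_copy + 'p ia_copy)) set" where
  "interface_IA \<Phi>BV \<Phi>IA =
     {(Inr (PIA p), Inl (PBV p)) |p. PIA p \<in> head_preds \<Phi>IA \<and> PBV p \<in> body_preds \<Phi>BV}"

definition modular_encoding ::
    "('v \<Rightarrow> 'u) \<Rightarrow> ('v bv_fm \<Rightarrow> 'u ia_fm) \<Rightarrow> ('u \<Rightarrow> 'u ia_fm) \<Rightarrow>
     ('v bv_fm, 'v, 'p) chc set \<Rightarrow> ('v bv_fm, 'v, 'p) chc set \<Rightarrow> ('v, 'u, 'p) encoding" where
  "modular_encoding pr \<tau> \<rho> \<Delta>BV \<Delta>IA =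
     (let \<Phi>BV = bv_clause ` \<Delta>BV; \<Phi>IA = ia_clause pr \<tau> \<rho> ` \<Delta>IA
      in \<lparr>clauses_BV = \<Phi>BV, clauses_IA = \<Phi>IA,
          interface = interface_BV \<Phi>BV \<Phi>IA \<union> interface_IA \<Phi>BV \<Phi>IA\<rparr>)"

text \<open>
  Bounded semantics of an encoding. \<open>D p\<close> is the domain and \<open>\<delta>p p\<close> the transformer of the
  predicate \<open>p\<close>; as \<open>\<delta>p p\<close> is a map on \<open>D p\<close>, its preimages are taken within \<open>D p\<close>.
\<close>

fun enc_sem_BV ::
    "('v bv_fm, 'v, bits) model \<Rightarrow> ('u ia_fm, 'u, int) model \<Rightarrow>
     ('p \<Rightarrow> bits list set) \<Rightarrow> ('p \<Rightarrow> bits list \<Rightarrow> int list) \<Rightarrow> ('v, 'u, 'p) encoding \<Rightarrow>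
     nat \<Rightarrow> 'p bv_copy \<Rightarrow> bits list set"
and enc_sem_IA ::
    "('v bv_fm, 'v, bits) model \<Rightarrow> ('u ia_fm, 'u, int) model \<Rightarrow>
     ('p \<Rightarrow> bits list set) \<Rightarrow> ('p \<Rightarrow> bits list \<Rightarrow> int list) \<Rightarrow> ('v, 'u, 'p) encoding \<Rightarrow>
     nat \<Rightarrow> 'p ia_copy \<Rightarrow> int list set" where
  "enc_sem_BV MBV MIA D \<delta>p E 0 q = rule_step MBV (clauses_BV E) (\<lambda>_. {}) q"
| "enc_sem_BV MBV MIA D \<delta>p E (Suc n) (PBV p) =
     rule_step MBV (clauses_BV E) (enc_sem_BV MBV MIA D \<delta>p E n) (PBV p) \<union>
     (if (Inr (PIA p), Inl (PBV p)) \<in> interface E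
      then {bs \<in> D p. \<delta>p p bs \<in> enc_sem_IA MBV MIA D \<delta>p E n (PIA p)} else {})"
| "enc_sem_IA MBV MIA D \<delta>p E 0 q = rule_step MIA (clauses_IA E) (\<lambda>_. {}) q"
| "enc_sem_IA MBV MIA D \<delta>p E (Suc n) (PIA p) =
     rule_step MIA (clauses_IA E) (enc_sem_IA MBV MIA D \<delta>p E n) (PIA p) \<union>
     (if (Inl (PBV p), Inr (PIA p)) \<in> interface E
      then \<delta>p p ` enc_sem_BV MBV MIA D \<delta>p E n (PBV p) else {})"

definition enc_satisfiable ::
    "('v bv_fm, 'v, bits) model \<Rightarrow> ('u ia_fm, 'u, int) model \<Rightarrow>
     ('p \<Rightarrow> bits list set) \<Rightarrow> ('p \<Rightarrow> bits list \<Rightarrow> int list) \<Rightarrow> ('v, 'u, 'p) encoding \<Rightarrow> bool" where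
  "enc_satisfiable MBV MIA D \<delta>p E \<longleftrightarrow>
     queries_true MBV (clauses_BV E) (\<lambda>q. \<Union>n. enc_sem_BV MBV MIA D \<delta>p E n q) \<and>
     queries_true MIA (clauses_IA E) (\<lambda>q. \<Union>n. enc_sem_IA MBV MIA D \<delta>p E n q)"

end

theory Submission
  imports Defs
begin

text \<open>
  A variable assignment satisfying the body of a clause over bit-vectors corresponds, through
  \<open>\<delta>\<close>, to one satisfying the body of its translation: from left to right this is the defining
  property of \<open>\<tau>\<close>; from right to left one first notes that every value lies in the image of
  \<open>\<delta>\<close>, either by a domain restriction or because the variable is an argument of some \<open>p\<^sup>I\<^sup>A\<close>,
  whose semantics consists of \<open>\<delta>\<close>-images. Hence the semantics of \<open>p\<^sup>B\<^sup>V\<close> and \<open>p\<^sup>I\<^sup>A\<close> are contained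
  in \<open>\<lbrakk>p\<rbrakk>\<close> and \<open>\<delta>\<^sub>p \<lbrakk>p\<rbrakk>\<close>. Equality is only guaranteed for copies that occur in the body of a clause
  of their theory, as only those import facts; but no other copy is ever consulted.
\<close>

section \<open>Monotonicity and continuity of clause bodies\<close>

lemma body_holds_mono:
  assumes "body_holds M J \<nu> c" "\<And>p xs. (p, xs) \<in> set (body c) \<Longrightarrow> J p \<subseteq> K p"
  shows "body_holds M K \<nu> c"
  using assms unfolding body_holds_def by blast

lemma rule_stepI:
  assumes "c \<in> \<Phi>" "head c = Some (p, xs)" "\<nu> \<in> assigns M" "body_holds M J \<nu> c"
  shows "map \<nu> xs \<in> rule_step M \<Phi> J p"
  using assms unfolding rule_step_def by blast

lemma rule_stepE:
  assumes "t \<in> rule_step M \<Phi> J p"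
  obtains c \<nu> xs where "c \<in> \<Phi>" "head c = Some (p, xs)" "\<nu> \<in> assigns M" "body_holds M J \<nu> c"
    "t = map \<nu> xs"
  using assms unfolding rule_step_def by blast

lemma rule_step_mono:
  assumes "\<And>p. J p \<subseteq> K p"
  shows "rule_step M \<Phi> J p \<subseteq> rule_step M \<Phi> K p"
proof
  fix t assume "t \<in> rule_step M \<Phi> J p"
  then obtain c \<nu> xs where c: "c \<in> \<Phi>" "head c = Some (p, xs)" "\<nu> \<in> assigns M"
    and b: "body_holds M J \<nu> c" and t: "t = map \<nu> xs"
    by (rule rule_stepE)
  show "t \<in> rule_step M \<Phi> K p"
    unfolding t using c body_holds_mono[OF b assms] by (rule rule_stepI)
qed

text \<open>A body has finitely many atoms, so along an increasing chain the largest of the stages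
  at which they hold serves all of them. This continuity lets the closure arguments below descend
  from a union of stages to a single stage.\<close>

lemma body_holds_chain:
  fixes J :: "nat \<Rightarrow> 'p \<Rightarrow> 'd list set"
  assumes mono: "\<And>n p. J n p \<subseteq> J (Suc n) p"
    and holds: "body_holds M (\<lambda>p. \<Union>n. J n p) \<nu> c"
  obtains n where "body_holds M (J n) \<nu> c"
proof -
  have le: "J m p \<subseteq> J n p" if "m \<le> n" for m n p
    using lift_Suc_mono_le[of "\<lambda>n. J n p"] mono that by blast
  have "\<forall>a\<in>set (body c). \<exists>n. map \<nu> (snd a) \<in> J n (fst a)"
    using holds unfolding body_holds_def by fastforce
  then obtain f where f: "\<forall>a\<in>set (body c). map \<nu> (snd a) \<in> J (f a) (fst a)"
    by metis
  \<comment> \<open>The inserted \<open>0\<close> keeps \<open>Max\<close> meaningful for a clause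
    with an empty body.\<close>
  define n where "n = Max (insert 0 (f ` set (body c)))"
  have "map \<nu> (snd a) \<in> J n (fst a)" if a: "a \<in> set (body c)" for a
  proof -
    have "f a \<le> n"
      unfolding n_def using a by (intro Max_ge) auto
    then show ?thesis
      using f a le by blast
  qed
  then have "body_holds M (J n) \<nu> c"
    using holds unfolding body_holds_def by auto
  then show thesis
    by (rule that)
qed

section \<open>Bounded stages of a clause set and their union\<close>

lemma bounded_sem_mono: "bounded_sem M \<Phi> n p \<subseteq> bounded_sem M \<Phi> (Suc n) p"
proof (induction n arbitrary: p)
  case 0
  show ?case
    by (simp, rule rule_step_mono) simp
next
  case (Suc n)
  show ?case
    unfolding bounded_sem.simps(2)[of M \<Phi> "Suc n"] bounded_sem.simps(2)[of M \<Phi> n]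
    using Suc.IH by (intro rule_step_mono) simp
qed

text \<open>By continuity a body true in the union is already true at some stage \<open>n\<close>,
  and its head value then enters at stage \<open>Suc n\<close>.\<close>

lemma rule_step_chc_sem: "rule_step M \<Phi> (chc_sem M \<Phi>) p \<subseteq> chc_sem M \<Phi> p"
proof
  fix t assume "t \<in> rule_step M \<Phi> (chc_sem M \<Phi>) p"
  then obtain c \<nu> xs where c: "c \<in> \<Phi>" "head c = Some (p, xs)" "\<nu> \<in> assigns M" "t = map \<nu> xs"
    and b: "body_holds M (chc_sem M \<Phi>) \<nu> c"
    by (auto elim: rule_stepE)
  from b have "body_holds M (\<lambda>p. \<Union>n. bounded_sem M \<Phi> n p) \<nu> c"
    unfolding body_holds_def chc_sem_def .
  then obtain n where "body_holds M (bounded_sem M \<Phi> n) \<nu> c"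
    by (rule body_holds_chain[where J = "bounded_sem M \<Phi>", OF bounded_sem_mono])
  then have "t \<in> bounded_sem M \<Phi> (Suc n) p"
    using c by (auto intro: rule_stepI)
  then show "t \<in> chc_sem M \<Phi> p"
    unfolding chc_sem_def by blast
qed

text \<open>Every stage, the first included, consists of head values of rules; this is how derived
  tuples are later seen to be well-sorted.\<close>

lemma chc_sem_in_rule_step:
  assumes "t \<in> bounded_sem M \<Phi> n p"
  obtains J where "t \<in> rule_step M \<Phi> J p"
  using assms by (cases n) auto

section \<open>Heads, bodies and constraints of translated clauses\<close>

lemma head_bv_clause [simp]: "head (bv_clause c) = map_option (map_prod PBV id) (head c)"
  by (cases c) simp

lemma body_bv_clause [simp]: "body (bv_clause c) = map (map_prod PBV id) (body c)"
  by (cases c) simp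

lemma constr_bv_clause [simp]: "constr (bv_clause c) = constr c"
  by (cases c) simp

lemma body_holds_bv_clause [simp]:
  "body_holds M J \<nu> (bv_clause c) \<longleftrightarrow> body_holds M (\<lambda>p. J (PBV p)) \<nu> c"
  unfolding body_holds_def by auto

lemma rule_step_bv_clause [simp]:
  "rule_step M (bv_clause ` \<Delta>) J (PBV p) = rule_step M \<Delta> (\<lambda>p. J (PBV p)) p"
proof -
  have "head (bv_clause c) = Some (PBV p, xs) \<longleftrightarrow> head c = Some (p, xs)" for c and xs :: "'b list"
    by auto
  then show ?thesis
    unfolding rule_step_def by simp
qed

lemma head_ia_clause [simp]:
  "head (ia_clause pr \<tau> \<rho> c) = map_option (map_prod PIA (map pr)) (head c)"
  by (cases c) (simp add: Let_def)

lemma body_ia_clause [simp]: "body (ia_clause pr \<tau> \<rho> c) = map (map_prod PIA (map pr)) (body c)"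
  by (cases c) (simp add: Let_def)

lemma rule_step_ia_clauseE:
  assumes "t \<in> rule_step M (ia_clause pr \<tau> \<rho> ` \<Delta>) K (PIA p)"
  obtains c \<mu> xs where "c \<in> \<Delta>" "head c = Some (p, xs)"
    "body_holds M K \<mu> (ia_clause pr \<tau> \<rho> c)" "t = map \<mu> (map pr xs)"
proof -
  obtain c' \<mu> us where c': "c' \<in> ia_clause pr \<tau> \<rho> ` \<Delta>" "head c' = Some (PIA p, us)"
    "body_holds M K \<mu> c'" "t = map \<mu> us"
    using assms by (rule rule_stepE)
  then obtain c where c: "c \<in> \<Delta>" "c' = ia_clause pr \<tau> \<rho> c"
    by blast
  then obtain xs where "head c = Some (p, xs)" "us = map pr xs"
    using c'(2) by auto
  then show thesis
    using c c' that by blast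
qed

lemma qf_holds_foldl_Conj:
  "qf_holds I (foldl Conj \<phi> \<psi>s) \<longleftrightarrow> qf_holds I \<phi> \<and> (\<forall>\<psi>\<in>set \<psi>s. qf_holds I \<psi>)"
  by (induction \<psi>s arbitrary: \<phi>) auto

text \<open>Unfolding the nested conjunction separates the transformed constraint from the domain
  restrictions, which concern just the clause variables outside all body atoms.\<close>

lemma holds_constr_ia_clause:
  "holds (M_IA d0 m0) \<mu> (constr (ia_clause pr \<tau> \<rho> c)) \<longleftrightarrow>
     holds (M_IA d0 m0) \<mu> (\<tau> (constr c)) \<and>
     (\<forall>x\<in>set (qvars c). (\<forall>(p, zs)\<in>set (body c). x \<notin> set zs) \<longrightarrow> holds (M_IA d0 m0) \<mu> (\<rho> (pr x)))"
  by (cases c) (auto simp: Let_def M_IA_def qf_holds_foldl_Conj)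

section \<open>Stages of the encoding and its interface\<close>

lemma enc_sem_mono:
  "enc_sem_BV MBV MIA D \<delta>p E n q \<subseteq> enc_sem_BV MBV MIA D \<delta>p E (Suc n) q"
  "enc_sem_IA MBV MIA D \<delta>p E n r \<subseteq> enc_sem_IA MBV MIA D \<delta>p E (Suc n) r"
\<comment> \<open>Both chains are treated at once because the external part of a stage reads the
  preceding stage of the other theory. Stage \<open>0\<close> has no external part.\<close>
proof (induction n arbitrary: q r)
  case 0
  {
    case 1
    show ?case
      by (cases q) (auto intro: subsetD[OF rule_step_mono, rotated])
  next
    case 2
    show ?case
      by (cases r) (auto intro: subsetD[OF rule_step_mono, rotated])
  }
next
  case (Suc n)
  {
    case 1
    obtain p where q: "q = PBV p"
      by (cases q)
    have "rule_step MBV (clauses_BV E) (enc_sem_BV MBV MIA D \<delta>p E n) (PBV p) \<subseteq>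
        rule_step MBV (clauses_BV E) (enc_sem_BV MBV MIA D \<delta>p E (Suc n)) (PBV p)"
      using Suc.IH(1) by (rule rule_step_mono)
    then show ?case
      using Suc.IH(2)[of "PIA p"]
      unfolding q enc_sem_BV.simps(2)[of MBV MIA D \<delta>p E "Suc n"]
        enc_sem_BV.simps(2)[of MBV MIA D \<delta>p E n] by (auto simp del: enc_sem_BV.simps enc_sem_IA.simps)
  next
    case 2
    obtain p where r: "r = PIA p"
      by (cases r)
    have "rule_step MIA (clauses_IA E) (enc_sem_IA MBV MIA D \<delta>p E n) (PIA p) \<subseteq>
        rule_step MIA (clauses_IA E) (enc_sem_IA MBV MIA D \<delta>p E (Suc n)) (PIA p)"
      using Suc.IH(2) by (rule rule_step_mono)
    then show ?case
      using Suc.IH(1)[of "PBV p"]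
      unfolding r enc_sem_IA.simps(2)[of MBV MIA D \<delta>p E "Suc n"]
        enc_sem_IA.simps(2)[of MBV MIA D \<delta>p E n] by (auto simp del: enc_sem_BV.simps enc_sem_IA.simps)
  }
qed

text \<open>With \<open>fst\<close>-images, renaming the clauses becomes a composition of images
  that \<open>image_image\<close> simplifies.\<close>

lemma body_preds_eq: "body_preds \<Phi> = (\<Union>c\<in>\<Phi>. fst ` set (body c))"
  unfolding Domain_fst[symmetric] body_preds_def by auto

lemma body_preds_bv_clause [simp]: "PBV p \<in> body_preds (bv_clause ` \<Delta>) \<longleftrightarrow> p \<in> body_preds \<Delta>"
  by (auto simp: body_preds_eq image_image)

lemma head_preds_bv_clause [simp]: "PBV p \<in> head_preds (bv_clause ` \<Delta>) \<longleftrightarrow> p \<in> head_preds \<Delta>"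
  unfolding head_preds_def by auto

lemma body_preds_ia_clause [simp]:
  "PIA p \<in> body_preds (ia_clause pr \<tau> \<rho> ` \<Delta>) \<longleftrightarrow> p \<in> body_preds \<Delta>"
  by (auto simp: body_preds_eq image_image)

lemma head_preds_ia_clause [simp]:
  "PIA p \<in> head_preds (ia_clause pr \<tau> \<rho> ` \<Delta>) \<longleftrightarrow> p \<in> head_preds \<Delta>"
  unfolding head_preds_def by auto

section \<open>Componentwise transformation of value tuples\<close>

lemma map_in_tuple_dom:
  assumes "\<nu> \<in> assigns (M_BV w)"
  shows "map \<nu> xs \<in> tuple_dom (map w xs)"
  using assms by (simp add: M_BV_def tuple_dom_def list_all2_conv_all_nth)

lemma tuple_transformer_map: "tuple_transformer \<delta> xs (map \<nu> xs) = map (\<lambda>x. \<delta> x (\<nu> x)) xs"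
  unfolding tuple_transformer_def by (induction xs) auto

lemma tuple_dom_map_iff:
  "bs \<in> tuple_dom (map w xs) \<longleftrightarrow> length bs = length xs \<and> (\<forall>i<length xs. bs ! i \<in> bv_dom (w (xs ! i)))"
  by (auto simp: tuple_dom_def list_all2_conv_all_nth)

text \<open>Since \<open>map2\<close> truncates, componentwise injectivity carries over only to
  tuples of full length; \<open>tuple_dom\<close> fixes the length as well as the widths.\<close>

lemma inj_on_tuple_transformer:
  assumes "\<And>x. inj_on (\<delta> x) (bv_dom (w x))"
  shows "inj_on (tuple_transformer \<delta> xs) (tuple_dom (map w xs))"
proof (rule inj_onI)
  fix bs bs' assume bs: "bs \<in> tuple_dom (map w xs)" "bs' \<in> tuple_dom (map w xs)"
    and eq: "tuple_transformer \<delta> xs bs = tuple_transformer \<delta> xs bs'"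
  show "bs = bs'"
  proof (rule nth_equalityI)
    show "length bs = length bs'"
      using bs by (simp add: tuple_dom_map_iff)
  next
    fix i assume "i < length bs"
    moreover have "tuple_transformer \<delta> xs bs ! i = tuple_transformer \<delta> xs bs' ! i"
      by (simp add: eq)
    ultimately show "bs ! i = bs' ! i"
      using bs assms[of "xs ! i"] by (auto simp: tuple_dom_map_iff tuple_transformer_def dest: inj_onD)
  qed
qed

section \<open>Transfer of single clauses through the transformers\<close>

locale transformed_chcs =
  fixes w :: "'v \<Rightarrow> nat"
    and ty :: "'p \<Rightarrow> nat list"
    and pr :: "'v \<Rightarrow> 'u"
    and d0 m0 :: "int \<Rightarrow> int"
    and \<Phi> :: "('v bv_fm, 'v, 'p) chc set"
    and \<delta> :: "'v \<Rightarrow> bits \<Rightarrow> int"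
    and \<rho> :: "'u \<Rightarrow> 'u ia_fm"
    and \<tau> :: "'v bv_fm \<Rightarrow> 'u ia_fm"
  assumes wf: "\<And>c. c \<in> \<Phi> \<Longrightarrow> wf_bv_chc w ty c"
    and domain_transformers: "domain_transformers w \<Phi> \<delta>"
    and domain_restriction: "domain_restriction w (M_IA d0 m0) pr \<delta> \<rho>"
    and theory_transformer: "theory_transformer w (M_IA d0 m0) pr \<delta> \<tau>"
begin

abbreviation "MBV \<equiv> M_BV w"
abbreviation "MIA \<equiv> M_IA d0 m0 :: ('u ia_fm, 'u, int) model"
abbreviation "\<delta>p \<equiv> pred_transformer \<delta> \<Phi>"
abbreviation "S \<equiv> chc_sem MBV \<Phi>"

lemma application_wf:
  assumes "(p, xs) \<in> applications \<Phi>"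
  shows "map w xs = ty p"
  using assms wf unfolding wf_bv_chc_def applications_def by fastforce

lemma body_application:
  assumes "c \<in> \<Phi>" "(p, xs) \<in> set (body c)"
  shows "(p, xs) \<in> applications \<Phi>" "set xs \<subseteq> set (qvars c)"
  using assms wf[of c] unfolding wf_bv_chc_def applications_def by fastforce+

lemma head_application:
  assumes "c \<in> \<Phi>" "head c = Some (p, xs)"
  shows "(p, xs) \<in> applications \<Phi>" "set xs \<subseteq> set (qvars c)"
  using assms wf[of c] unfolding wf_bv_chc_def applications_def by fastforce+

text \<open>The tuple picked by \<open>SOME\<close> is typed like \<open>xs\<close>, and uniformity
  makes both transform each component alike on its domain. Thus any application at hand may replace
  the chosen one.\<close>

lemma pred_transformer_eq:
  assumes xs: "(p, xs) \<in> applications \<Phi>" and bs: "bs \<in> tuple_dom (ty p)"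
  shows "\<delta>p p bs = tuple_transformer \<delta> xs bs"
proof -
  define ys where "ys = (SOME xs. (p, xs) \<in> applications \<Phi>)"
  have ys: "(p, ys) \<in> applications \<Phi>"
    unfolding ys_def using xs by (rule someI)
  have len: "length ys = length xs" "length bs = length xs"
    and dom: "\<forall>i<length xs. bs ! i \<in> bv_dom (w (xs ! i))"
    using application_wf[OF xs] application_wf[OF ys] bs tuple_dom_map_iff[of bs w xs]
    by (simp, metis length_map)+
  have "map2 \<delta> ys bs = map2 \<delta> xs bs"
  proof (rule nth_equalityI)
    fix i assume "i < length (map2 \<delta> ys bs)"
    then have i: "i < length xs"
      using len by simp
    have "\<delta> (xs ! i) (bs ! i) = \<delta> (ys ! i) (bs ! i)"
      using domain_transformers xs ys i len dom unfolding domain_transformers_def by metis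
    then show "map2 \<delta> ys bs ! i = map2 \<delta> xs bs ! i"
      using i len by simp
  qed (simp add: len)
  then show ?thesis
    unfolding pred_transformer_def tuple_transformer_def ys_def .
qed

lemma map_in_dom:
  assumes "(p, xs) \<in> applications \<Phi>" "\<nu> \<in> assigns MBV"
  shows "map \<nu> xs \<in> tuple_dom (ty p)"
  using map_in_tuple_dom[OF assms(2), of xs] application_wf[OF assms(1)] by simp

lemma pred_transformer_map:
  assumes "(p, xs) \<in> applications \<Phi>" "\<nu> \<in> assigns MBV"
  shows "\<delta>p p (map \<nu> xs) = map (\<lambda>x. \<delta> x (\<nu> x)) xs"
  using pred_transformer_eq[OF assms(1) map_in_dom[OF assms]] tuple_transformer_map by metis

lemma inj_on_transformer: "inj_on (\<delta> x) (bv_dom (w x))"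
  using domain_transformers unfolding domain_transformers_def by blast

lemma inj_on_pred_transformer:
  assumes "(p, xs) \<in> applications \<Phi>"
  shows "inj_on (\<delta>p p) (tuple_dom (ty p))"
proof -
  have "inj_on (tuple_transformer \<delta> xs) (tuple_dom (ty p))"
    using inj_on_tuple_transformer[of \<delta> w xs] inj_on_transformer application_wf[OF assms] by simp
  then show ?thesis
    using pred_transformer_eq[OF assms] by (simp cong: inj_on_cong)
qed

text \<open>Derived tuples are head arguments under sort-respecting assignments. The bound matters
  because injectivity of \<open>\<delta>p p\<close> is available on well-sorted tuples.\<close>

lemma chc_sem_dom: "S p \<subseteq> tuple_dom (ty p)"
proof
  fix t assume "t \<in> S p"
  then obtain J where "t \<in> rule_step MBV \<Phi> J p"
    unfolding chc_sem_def by (blast elim: chc_sem_in_rule_step)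
  then show "t \<in> tuple_dom (ty p)"
    by (auto elim!: rule_stepE intro: map_in_dom dest: head_application)
qed

text \<open>For a well-sorted \<open>bs\<close> the intersection with the image in the condition on
  \<open>\<tau>\<close> holds automatically, and \<open>qvars c\<close> lists exactly the free
  variables of the constraint.\<close>

lemma solutions_iff:
  assumes "c \<in> \<Phi>" "bs \<in> tuple_dom (map w (qvars c))"
  shows "bs \<in> solutions MBV (constr c) (qvars c) \<longleftrightarrow>
    tuple_transformer \<delta> (qvars c) bs \<in> solutions MIA (\<tau> (constr c)) (map pr (qvars c))"
  using theory_transformer wf[OF assms(1)] assms(2)
  unfolding theory_transformer_def wf_bv_chc_def by blast

lemma constraint_to_IA:
  assumes c: "c \<in> \<Phi>" and \<nu>: "\<nu> \<in> assigns MBV" "holds MBV \<nu> (constr c)"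
  obtains \<mu> where "holds MIA \<mu> (\<tau> (constr c))" "\<forall>x\<in>set (qvars c). \<mu> (pr x) = \<delta> x (\<nu> x)"
proof -
  have "map \<nu> (qvars c) \<in> solutions MBV (constr c) (qvars c)"
    using \<nu> unfolding solutions_def by blast
  then have "map (\<lambda>x. \<delta> x (\<nu> x)) (qvars c) \<in> solutions MIA (\<tau> (constr c)) (map pr (qvars c))"
    using solutions_iff[OF c map_in_tuple_dom[OF \<nu>(1)]] by (simp add: tuple_transformer_map)
  then show thesis
    unfolding solutions_def by (auto intro: that)
qed

lemma constraint_to_BV:
  assumes c: "c \<in> \<Phi>" and \<mu>: "holds MIA \<mu> (\<tau> (constr c))"
    and range: "\<forall>x\<in>set (qvars c). \<mu> (pr x) \<in> \<delta> x ` bv_dom (w x)"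
  obtains \<nu> where "\<nu> \<in> assigns MBV" "holds MBV \<nu> (constr c)"
    "\<forall>x\<in>set (qvars c). \<mu> (pr x) = \<delta> x (\<nu> x)"
proof -
  \<comment> \<open>Variables outside the clause receive an arbitrary vector of their width, so that
    the assignment respects all sorts.\<close>
  have "\<forall>x. \<exists>b\<in>bv_dom (w x). x \<in> set (qvars c) \<longrightarrow> \<mu> (pr x) = \<delta> x b"
    using range Ex_list_of_length unfolding bv_dom_def by blast
  then obtain \<nu> where \<nu>: "\<nu> x \<in> bv_dom (w x)" "x \<in> set (qvars c) \<Longrightarrow> \<mu> (pr x) = \<delta> x (\<nu> x)" for x
    by metis
  have assign: "\<nu> \<in> assigns MBV"
    using \<nu>(1) by (simp add: M_BV_def)
  have "tuple_transformer \<delta> (qvars c) (map \<nu> (qvars c)) = map \<mu> (map pr (qvars c))"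
    using \<nu>(2) by (simp add: tuple_transformer_map)
  moreover have "map \<mu> (map pr (qvars c)) \<in> solutions MIA (\<tau> (constr c)) (map pr (qvars c))"
    using \<mu> unfolding solutions_def by (auto simp: M_IA_def)
  ultimately have "map \<nu> (qvars c) \<in> solutions MBV (constr c) (qvars c)"
    using solutions_iff[OF c map_in_tuple_dom[OF assign]] by simp
  \<comment> \<open>Membership in \<open>solutions\<close> fixes an assignment only on the clause
    variables, so the witness may differ from \<open>\<nu>\<close> elsewhere.\<close>
  then obtain \<nu>' where "\<nu>' \<in> assigns MBV" "holds MBV \<nu>' (constr c)"
    "map \<nu> (qvars c) = map \<nu>' (qvars c)"
    unfolding solutions_def by blast
  then show thesis
    using \<nu>(2) by (auto intro: that)
qed

text \<open>The domain restrictions hold because every clause variable is sent to a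
  \<open>\<delta>\<close>-image. \<open>K\<close> is compared with \<open>J\<close> only on body
  predicates, since other integer copies may lack facts.\<close>

lemma body_to_IA:
  assumes c: "c \<in> \<Phi>" and \<nu>: "\<nu> \<in> assigns MBV" and b: "body_holds MBV J \<nu> c"
    and JK: "\<And>q zs. (q, zs) \<in> set (body c) \<Longrightarrow> \<delta>p q ` J q \<subseteq> K (PIA q)"
  obtains \<mu> where "body_holds MIA K \<mu> (ia_clause pr \<tau> \<rho> c)"
    "\<forall>x\<in>set (qvars c). \<mu> (pr x) = \<delta> x (\<nu> x)"
proof -
  obtain \<mu> where \<mu>: "holds MIA \<mu> (\<tau> (constr c))"
    and eq: "\<forall>x\<in>set (qvars c). \<mu> (pr x) = \<delta> x (\<nu> x)"
    using constraint_to_IA[OF c \<nu>] b unfolding body_holds_def by blast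
  have "holds MIA \<mu> (\<rho> (pr x))" if "x \<in> set (qvars c)" for x
    using domain_restriction eq \<nu> that unfolding domain_restriction_def
    by (simp add: M_IA_def M_BV_def)
  moreover have "map \<mu> (map pr zs) \<in> K (PIA q)" if q: "(q, zs) \<in> set (body c)" for q zs
  proof -
    have "map \<mu> (map pr zs) = \<delta>p q (map \<nu> zs)"
      using eq pred_transformer_map[OF body_application(1)[OF c q] \<nu>] body_application(2)[OF c q]
      by auto
    moreover have "map \<nu> zs \<in> J q"
      using b q unfolding body_holds_def by blast
    ultimately show ?thesis
      using JK[OF q] by auto
  qed
  ultimately have "body_holds MIA K \<mu> (ia_clause pr \<tau> \<rho> c)"
    using \<mu> unfolding body_holds_def holds_constr_ia_clause by auto
  then show thesis
    using eq by (rule that)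
qed

text \<open>Once all values are known to be \<open>\<delta>\<close>-images, the condition on
  \<open>\<tau>\<close> yields \<open>\<nu>\<close>; injectivity then shows that its body tuples are
  the very ones that \<open>J\<close> contains.\<close>

lemma body_to_BV:
  assumes c: "c \<in> \<Phi>" and b: "body_holds MIA K \<mu> (ia_clause pr \<tau> \<rho> c)"
    and KJ: "\<And>q. K (PIA q) \<subseteq> \<delta>p q ` J q" and J: "\<And>q. J q \<subseteq> tuple_dom (ty q)"
  obtains \<nu> where "\<nu> \<in> assigns MBV" "body_holds MBV J \<nu> c"
    "\<forall>x\<in>set (qvars c). \<mu> (pr x) = \<delta> x (\<nu> x)"
proof -
  have body: "\<exists>bs\<in>J q. map \<mu> (map pr zs) = \<delta>p q bs" if "(q, zs) \<in> set (body c)" for q zs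
    using b that KJ unfolding body_holds_def by fastforce
  have constr: "holds MIA \<mu> (\<tau> (constr c))"
    and restr: "x \<in> set (qvars c) \<Longrightarrow> \<forall>(q, zs)\<in>set (body c). x \<notin> set zs \<Longrightarrow>
      holds MIA \<mu> (\<rho> (pr x))" for x
    using b unfolding body_holds_def holds_constr_ia_clause by blast+
  have "\<mu> (pr x) \<in> \<delta> x ` bv_dom (w x)" if x: "x \<in> set (qvars c)" for x
  proof (cases "\<forall>(q, zs)\<in>set (body c). x \<notin> set zs")
    case True
    then show ?thesis
      using restr[OF x] domain_restriction unfolding domain_restriction_def
      by (simp add: M_IA_def)
  next
    case False
    then obtain q zs where q: "(q, zs) \<in> set (body c)" and "x \<in> set zs"
      by blast
    then obtain i where i: "i < length zs" "x = zs ! i"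
      by (metis in_set_conv_nth)
    obtain bs where "bs \<in> J q" and eq: "map \<mu> (map pr zs) = \<delta>p q bs"
      using body[OF q] by blast
    then have bs: "bs \<in> tuple_dom (ty q)"
      using J by blast
    note app = body_application(1)[OF c q]
    have dom: "bs \<in> tuple_dom (map w zs)"
      using bs application_wf[OF app] by simp
    \<comment> \<open>Component \<open>i\<close> of the transformed tuple is
      \<open>\<delta> x\<close> applied to a vector of width \<open>w x\<close>.\<close>
    have "map \<mu> (map pr zs) ! i = tuple_transformer \<delta> zs bs ! i"
      using eq pred_transformer_eq[OF app bs] by simp
    then show ?thesis
      using i dom by (simp add: tuple_dom_map_iff tuple_transformer_def)
  qed
  then obtain \<nu> where \<nu>: "\<nu> \<in> assigns MBV" "holds MBV \<nu> (constr c)"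
    and eq: "\<forall>x\<in>set (qvars c). \<mu> (pr x) = \<delta> x (\<nu> x)"
    using constraint_to_BV[OF c constr] by blast
  have "map \<nu> zs \<in> J q" if q: "(q, zs) \<in> set (body c)" for q zs
  proof -
    note app = body_application[OF c q]
    obtain bs where bs: "bs \<in> J q" "map \<mu> (map pr zs) = \<delta>p q bs"
      using body[OF q] by blast
    have "map \<mu> (map pr zs) = \<delta>p q (map \<nu> zs)"
      using eq pred_transformer_map[OF app(1) \<nu>(1)] app(2) by auto
    \<comment> \<open>Both tuples are well-sorted and have the same image under
      \<open>\<delta>p q\<close>.\<close>
    then have "map \<nu> zs = bs"
      using inj_on_pred_transformer[OF app(1)] map_in_dom[OF app(1) \<nu>(1)] bs J
      by (metis inj_onD subsetD)
    then show ?thesis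
      using bs by simp
  qed
  then have "body_holds MBV J \<nu> c"
    using \<nu> unfolding body_holds_def by blast
  then show thesis
    using \<nu>(1) eq that by blast
qed

lemma head_transfer:
  assumes "c \<in> \<Phi>" "head c = Some (p, xs)" "\<nu> \<in> assigns MBV"
    "\<forall>x\<in>set (qvars c). \<mu> (pr x) = \<delta> x (\<nu> x)"
  shows "map \<mu> (map pr xs) = \<delta>p p (map \<nu> xs)"
  using pred_transformer_map[OF head_application(1)[OF assms(1,2)] assms(3)]
    head_application(2)[OF assms(1,2)] assms(4) by auto

end

section \<open>Soundness of the encoding\<close>

locale modular_chcs = transformed_chcs w ty pr d0 m0 \<Phi> \<delta> \<rho> \<tau>
  for w :: "'v \<Rightarrow> nat"
    and ty :: "'p \<Rightarrow> nat list"
    and pr :: "'v \<Rightarrow> 'u"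
    and d0 m0 \<Phi> \<delta> \<rho> \<tau> +
  fixes \<Delta>BV \<Delta>IA :: "('v bv_fm, 'v, 'p) chc set"
  assumes split: "\<Phi> = \<Delta>BV \<union> \<Delta>IA"
begin

abbreviation "E \<equiv> modular_encoding pr \<tau> \<rho> \<Delta>BV \<Delta>IA"
abbreviation "A \<equiv> enc_sem_BV MBV MIA (\<lambda>p. tuple_dom (ty p)) \<delta>p E"
abbreviation "B \<equiv> enc_sem_IA MBV MIA (\<lambda>p. tuple_dom (ty p)) \<delta>p E"

lemma clauses_encoding [simp]:
  "clauses_BV E = bv_clause ` \<Delta>BV"
  "clauses_IA E = ia_clause pr \<tau> \<rho> ` \<Delta>IA"
  by (simp_all add: modular_encoding_def Let_def)

lemma interface_encoding [simp]:
  "(Inl (PBV p), Inr (PIA p)) \<in> interface E \<longleftrightarrow> p \<in> head_preds \<Delta>BV \<and> p \<in> body_preds \<Delta>IA"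
  "(Inr (PIA p), Inl (PBV p)) \<in> interface E \<longleftrightarrow> p \<in> head_preds \<Delta>IA \<and> p \<in> body_preds \<Delta>BV"
  by (simp_all add: modular_encoding_def Let_def interface_BV_def interface_IA_def)

lemma rule_step_BV_sound:
  assumes "\<And>q. J (PBV q) \<subseteq> S q"
  shows "rule_step MBV (clauses_BV E) J (PBV p) \<subseteq> S p"
proof -
  have "rule_step MBV \<Delta>BV (\<lambda>q. J (PBV q)) p \<subseteq> rule_step MBV \<Phi> (\<lambda>q. J (PBV q)) p"
    unfolding rule_step_def split by blast
  also have "\<dots> \<subseteq> rule_step MBV \<Phi> S p"
    using assms by (rule rule_step_mono)
  also have "\<dots> \<subseteq> S p"
    by (rule rule_step_chc_sem)
  finally show ?thesis
    by simp
qed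

text \<open>A satisfying integer assignment is pulled back to bit-vectors, the original clause fires
  in \<open>S\<close>, and its head value is pushed forward again by
  \<open>\<delta>p p\<close>.\<close>

lemma rule_step_IA_sound:
  assumes K: "\<And>q. K (PIA q) \<subseteq> \<delta>p q ` S q"
  shows "rule_step MIA (clauses_IA E) K (PIA p) \<subseteq> \<delta>p p ` S p"
proof
  fix t assume "t \<in> rule_step MIA (clauses_IA E) K (PIA p)"
  then obtain c \<mu> xs where c: "c \<in> \<Delta>IA" and h: "head c = Some (p, xs)"
    and b: "body_holds MIA K \<mu> (ia_clause pr \<tau> \<rho> c)" and t: "t = map \<mu> (map pr xs)"
    unfolding clauses_encoding by (rule rule_step_ia_clauseE)
  have c': "c \<in> \<Phi>"
    using c split by blast
  obtain \<nu> where \<nu>: "\<nu> \<in> assigns MBV" "body_holds MBV S \<nu> c"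
    "\<forall>x\<in>set (qvars c). \<mu> (pr x) = \<delta> x (\<nu> x)"
    using body_to_BV[OF c' b K chc_sem_dom] .
  have "map \<nu> xs \<in> S p"
    using rule_stepI[OF c' h \<nu>(1,2)] by (rule subsetD[OF rule_step_chc_sem])
  then show "t \<in> \<delta>p p ` S p"
    using t head_transfer[OF c' h \<nu>(1,3)] by blast
qed

text \<open>Rules preserve both bounds, and so does the interface: passing to the integers applies
  \<open>\<delta>p p\<close> to a subset of \<open>S p\<close>, while passing back undoes it by
  injectivity.\<close>

lemma enc_sem_sound: "A n (PBV p) \<subseteq> S p" "B n (PIA p) \<subseteq> \<delta>p p ` S p"
proof (induction n arbitrary: p)
  case 0
  {
    case 1
    show ?case
      unfolding enc_sem_BV.simps by (rule rule_step_BV_sound) simp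
  next
    case 2
    show ?case
      unfolding enc_sem_IA.simps by (rule rule_step_IA_sound) simp
  }
next
  case (Suc n)
  {
    case 1
    have "bs \<in> S p" if p: "p \<in> head_preds \<Delta>IA" and bs: "bs \<in> tuple_dom (ty p)"
      and B: "\<delta>p p bs \<in> B n (PIA p)" for bs
    proof -
      \<comment> \<open>A predicate imported from the integers heads a clause of
        \<open>\<Delta>IA\<close>, which supplies the application through which
        \<open>\<delta>p p\<close> is known to be injective.\<close>
      obtain xs where app: "(p, xs) \<in> applications \<Phi>"
        using p head_application unfolding head_preds_def split by blast
      obtain bs' where bs': "bs' \<in> S p" "\<delta>p p bs = \<delta>p p bs'"
        using B Suc.IH(2) by blast
      then have "bs = bs'"
        using inj_on_pred_transformer[OF app] bs chc_sem_dom by (metis inj_onD subsetD)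
      then show ?thesis
        using bs' by simp
    qed
    then show ?case
      using rule_step_BV_sound[OF Suc.IH(1)] by (auto simp del: clauses_encoding)
  next
    case 2
    show ?case
      using rule_step_IA_sound[OF Suc.IH(2)] Suc.IH(1)[of p] by (auto simp del: clauses_encoding)
  }
qed

section \<open>Completeness for the copies occurring in bodies\<close>

lemma rule_BV_complete:
  assumes c: "c \<in> \<Delta>BV" and h: "head c = Some (p, xs)" and \<nu>: "\<nu> \<in> assigns MBV"
    and b: "body_holds MBV (\<lambda>q. \<Union>n. A n (PBV q)) \<nu> c"
  shows "map \<nu> xs \<in> (\<Union>n. A n (PBV p))"
    and "p \<in> body_preds \<Delta>IA \<Longrightarrow> \<delta>p p (map \<nu> xs) \<in> (\<Union>n. B n (PIA p))"
proof -
  obtain n where "body_holds MBV (\<lambda>q. A n (PBV q)) \<nu> c"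
    using body_holds_chain[where J = "\<lambda>n q. A n (PBV q)", OF _ b] enc_sem_mono(1) by blast
  then have A: "map \<nu> xs \<in> A (Suc n) (PBV p)"
    using rule_stepI[OF c h \<nu>] by simp
  then show "map \<nu> xs \<in> (\<Union>n. A n (PBV p))"
    by blast
  assume "p \<in> body_preds \<Delta>IA"
  moreover have "p \<in> head_preds \<Delta>BV"
    using c h unfolding head_preds_def by blast
  \<comment> \<open>One \<open>Suc\<close> accounts for firing the rule, the other for crossing the
    interface.\<close>
  ultimately have "\<delta>p p (map \<nu> xs) \<in> B (Suc (Suc n)) (PIA p)"
    using A by (simp del: enc_sem_BV.simps)
  then show "\<delta>p p (map \<nu> xs) \<in> (\<Union>n. B n (PIA p))"
    by blast
qed

lemma rule_IA_complete:
  assumes c: "c \<in> \<Delta>IA" and h: "head c = Some (p, xs)" and \<nu>: "\<nu> \<in> assigns MBV"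
    and eq: "\<forall>x\<in>set (qvars c). \<mu> (pr x) = \<delta> x (\<nu> x)"
    and b: "body_holds MIA (\<lambda>q. \<Union>n. B n q) \<mu> (ia_clause pr \<tau> \<rho> c)"
  shows "\<delta>p p (map \<nu> xs) \<in> (\<Union>n. B n (PIA p))"
    and "p \<in> body_preds \<Delta>BV \<Longrightarrow> map \<nu> xs \<in> (\<Union>n. A n (PBV p))"
proof -
  have c': "c \<in> \<Phi>"
    using c split by blast
  obtain n where n: "body_holds MIA (B n) \<mu> (ia_clause pr \<tau> \<rho> c)"
    using body_holds_chain[where J = B, OF _ b] enc_sem_mono(2) by blast
  have "map \<mu> (map pr xs) \<in> rule_step MIA (clauses_IA E) (B n) (PIA p)"
    using c h n by (intro rule_stepI[where c = "ia_clause pr \<tau> \<rho> c"]) (auto simp: M_IA_def)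
  then have B: "\<delta>p p (map \<nu> xs) \<in> B (Suc n) (PIA p)"
    using head_transfer[OF c' h \<nu> eq] by simp
  then show "\<delta>p p (map \<nu> xs) \<in> (\<Union>n. B n (PIA p))"
    by blast
  assume "p \<in> body_preds \<Delta>BV"
  moreover have "p \<in> head_preds \<Delta>IA"
    using c h unfolding head_preds_def by blast
  \<comment> \<open>The import into the bit-vector copy takes preimages within
    \<open>tuple_dom (ty p)\<close>.\<close>
  moreover have "map \<nu> xs \<in> tuple_dom (ty p)"
    using map_in_dom[OF head_application(1)[OF c' h] \<nu>] .
  ultimately have "map \<nu> xs \<in> A (Suc (Suc n)) (PBV p)"
    using B by (simp del: enc_sem_IA.simps)
  then show "map \<nu> xs \<in> (\<Union>n. A n (PBV p))"
    by blast
qed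

text \<open>This is the inductive step. A clause reads only copies that occur in bodies of its own
  theory, so \<open>JA\<close> or \<open>JB\<close> covers its body; the derived fact is local to
  that theory and crosses the interface if a body of the other theory mentions
  \<open>p\<close>.\<close>

lemma rule_step_complete:
  assumes t: "t \<in> rule_step MBV \<Phi> J p"
    and JA: "\<And>q. q \<in> body_preds \<Delta>BV \<Longrightarrow> J q \<subseteq> (\<Union>n. A n (PBV q))"
    and JB: "\<And>q. q \<in> body_preds \<Delta>IA \<Longrightarrow> \<delta>p q ` J q \<subseteq> (\<Union>n. B n (PIA q))"
  shows "p \<in> body_preds \<Delta>BV \<Longrightarrow> t \<in> (\<Union>n. A n (PBV p))"
    and "p \<in> body_preds \<Delta>IA \<Longrightarrow> \<delta>p p t \<in> (\<Union>n. B n (PIA p))"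
proof -
  from t obtain c \<nu> xs where c: "c \<in> \<Phi>" and h: "head c = Some (p, xs)"
    and \<nu>: "\<nu> \<in> assigns MBV" and b: "body_holds MBV J \<nu> c" and t: "t = map \<nu> xs"
    by (rule rule_stepE)
  have "(p \<in> body_preds \<Delta>BV \<longrightarrow> t \<in> (\<Union>n. A n (PBV p))) \<and>
    (p \<in> body_preds \<Delta>IA \<longrightarrow> \<delta>p p t \<in> (\<Union>n. B n (PIA p)))"
  proof (cases "c \<in> \<Delta>BV")
    case True
    have "body_holds MBV (\<lambda>q. \<Union>n. A n (PBV q)) \<nu> c"
      using b
    proof (rule body_holds_mono)
      fix q zs assume "(q, zs) \<in> set (body c)"
      then show "J q \<subseteq> (\<Union>n. A n (PBV q))"
        using True by (intro JA) (auto simp: body_preds_def)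
    qed
    from rule_BV_complete[OF True h \<nu> this] show ?thesis
      unfolding t by blast
  next
    case False
    then have c': "c \<in> \<Delta>IA"
      using c split by blast
    have "\<delta>p q ` J q \<subseteq> (\<Union>n. B n (PIA q))" if "(q, zs) \<in> set (body c)" for q zs
      using that c' by (intro JB) (auto simp: body_preds_def)
    then obtain \<mu> where "body_holds MIA (\<lambda>q. \<Union>n. B n q) \<mu> (ia_clause pr \<tau> \<rho> c)"
      "\<forall>x\<in>set (qvars c). \<mu> (pr x) = \<delta> x (\<nu> x)"
      using body_to_IA[OF c \<nu> b, of "\<lambda>q. \<Union>n. B n q"] by blast
    from rule_IA_complete[OF c' h \<nu> this(2,1)] show ?thesis
      unfolding t by blast
  qed
  then show "p \<in> body_preds \<Delta>BV \<Longrightarrow> t \<in> (\<Union>n. A n (PBV p))"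
    and "p \<in> body_preds \<Delta>IA \<Longrightarrow> \<delta>p p t \<in> (\<Union>n. B n (PIA p))"
    by blast+
qed

text \<open>The right-hand sides range over all stages because interface crossings delay facts in
  the encoding.\<close>

lemma bounded_sem_complete:
  "p \<in> body_preds \<Delta>BV \<Longrightarrow> bounded_sem MBV \<Phi> n p \<subseteq> (\<Union>n. A n (PBV p))"
  "p \<in> body_preds \<Delta>IA \<Longrightarrow> \<delta>p p ` bounded_sem MBV \<Phi> n p \<subseteq> (\<Union>n. B n (PIA p))"
proof (induction n arbitrary: p)
  case 0
  {
    case 1
    then show ?case
      using rule_step_complete(1)[where J = "\<lambda>_. {}"] by auto
  next
    case 2
    then show ?case
      using rule_step_complete(2)[where J = "\<lambda>_. {}"] by auto
  }
next
  case (Suc n)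
  {
    case 1
    then show ?case
      using rule_step_complete(1)[OF _ Suc.IH] by auto
  next
    case 2
    then show ?case
      using rule_step_complete(2)[OF _ Suc.IH] by auto
  }
qed

lemma chc_sem_complete:
  "p \<in> body_preds \<Delta>BV \<Longrightarrow> S p \<subseteq> (\<Union>n. A n (PBV p))"
  "p \<in> body_preds \<Delta>IA \<Longrightarrow> \<delta>p p ` S p \<subseteq> (\<Union>n. B n (PIA p))"
  unfolding chc_sem_def image_UN using bounded_sem_complete by (intro UN_least; simp)+

section \<open>Queries and satisfiability\<close>

lemma query_BV_iff:
  assumes "c \<in> \<Delta>BV"
  shows "body_holds MBV (\<lambda>q. \<Union>n. A n q) \<nu> (bv_clause c) \<longleftrightarrow> body_holds MBV S \<nu> c"
proof -
  \<comment> \<open>Soundness and completeness meet here, as \<open>q\<close> occurs in a body of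
    \<open>\<Delta>BV\<close>.\<close>
  have "(\<Union>n. A n (PBV q)) = S q" if q: "(q, zs) \<in> set (body c)" for q zs
  proof -
    have "q \<in> body_preds \<Delta>BV"
      using q assms unfolding body_preds_def by blast
    then show ?thesis
      using enc_sem_sound(1)[of _ q] chc_sem_complete(1)[of q] by blast
  qed
  then show ?thesis
    unfolding body_holds_bv_clause by (blast intro: body_holds_mono)
qed

text \<open>The two sides use assignments of different models, so only the existence of a satisfying
  one is compared; \<open>body_to_BV\<close> and \<open>body_to_IA\<close> convert the
  witnesses.\<close>

lemma query_IA_iff:
  assumes c: "c \<in> \<Delta>IA"
  shows "(\<exists>\<mu>\<in>assigns MIA. body_holds MIA (\<lambda>q. \<Union>n. B n q) \<mu> (ia_clause pr \<tau> \<rho> c)) \<longleftrightarrow>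
    (\<exists>\<nu>\<in>assigns MBV. body_holds MBV S \<nu> c)"
proof -
  have c': "c \<in> \<Phi>"
    using c split by blast
  have sound: "(\<Union>n. B n (PIA q)) \<subseteq> \<delta>p q ` S q" for q
    using enc_sem_sound(2) by blast
  have complete: "\<delta>p q ` S q \<subseteq> (\<Union>n. B n (PIA q))" if "(q, zs) \<in> set (body c)" for q zs
    using that c by (intro chc_sem_complete(2)) (auto simp: body_preds_def)
  show ?thesis
  proof
    assume "\<exists>\<mu>\<in>assigns MIA. body_holds MIA (\<lambda>q. \<Union>n. B n q) \<mu> (ia_clause pr \<tau> \<rho> c)"
    then obtain \<mu> where "body_holds MIA (\<lambda>q. \<Union>n. B n q) \<mu> (ia_clause pr \<tau> \<rho> c)"
      by blast
    from body_to_BV[OF c' this sound chc_sem_dom] show "\<exists>\<nu>\<in>assigns MBV. body_holds MBV S \<nu> c"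
      by blast
  next
    assume "\<exists>\<nu>\<in>assigns MBV. body_holds MBV S \<nu> c"
    then obtain \<nu> where \<nu>: "\<nu> \<in> assigns MBV" "body_holds MBV S \<nu> c"
      by blast
    obtain \<mu> where "body_holds MIA (\<lambda>q. \<Union>n. B n q) \<mu> (ia_clause pr \<tau> \<rho> c)"
      by (rule body_to_IA[OF c' \<nu>, where K = "\<lambda>q. \<Union>n. B n q", OF complete])
    then show "\<exists>\<mu>\<in>assigns MIA. body_holds MIA (\<lambda>q. \<Union>n. B n q) \<mu> (ia_clause pr \<tau> \<rho> c)"
      by (auto simp: M_IA_def)
  qed
qed

lemma satisfiable_iff:
  "chc_satisfiable MBV \<Phi> \<longleftrightarrow> enc_satisfiable MBV MIA (\<lambda>p. tuple_dom (ty p)) \<delta>p E"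
proof -
  have "queries_true MBV (clauses_BV E) (\<lambda>q. \<Union>n. A n q) \<longleftrightarrow> queries_true MBV \<Delta>BV S"
    unfolding queries_true_def by (simp add: query_BV_iff del: body_holds_bv_clause)
  moreover have "queries_true MIA (clauses_IA E) (\<lambda>q. \<Union>n. B n q) \<longleftrightarrow> queries_true MBV \<Delta>IA S"
    unfolding queries_true_def using query_IA_iff by auto
  moreover have "queries_true MBV \<Phi> S \<longleftrightarrow> queries_true MBV \<Delta>BV S \<and> queries_true MBV \<Delta>IA S"
    unfolding queries_true_def split by blast
  ultimately show ?thesis
    unfolding chc_satisfiable_def enc_satisfiable_def by simp
qed

end

theorem theorem1:
  fixes w :: "'v \<Rightarrow> nat"
    and ty :: "'p \<Rightarrow> nat list"
    and pr :: "'v \<Rightarrow> 'u"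
    and d0 m0 :: "int \<Rightarrow> int"
    and \<Phi> \<Delta>BV \<Delta>IA :: "('v bv_fm, 'v, 'p) chc set"
    and \<delta> :: "'v \<Rightarrow> bits \<Rightarrow> int"
    and \<rho> :: "'u \<Rightarrow> 'u ia_fm"
    and \<tau> :: "'v bv_fm \<Rightarrow> 'u ia_fm"
  assumes "\<And>x. 1 \<le> w x"
    and "\<And>p n. n \<in> set (ty p) \<Longrightarrow> 1 \<le> n"
    and "\<And>c. c \<in> \<Phi> \<Longrightarrow> wf_bv_chc w ty c"
    and "\<Delta>BV \<subseteq> \<Phi>"
    and "\<Delta>IA = \<Phi> - \<Delta>BV"
    and "bij pr"
    and "domain_transformers w \<Phi> \<delta>"
    and "domain_restriction w (M_IA d0 m0) pr \<delta> \<rho>"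
    and "theory_transformer w (M_IA d0 m0) pr \<delta> \<tau>"
  shows "chc_satisfiable (M_BV w) \<Phi> \<longleftrightarrow>
    enc_satisfiable (M_BV w) (M_IA d0 m0) (\<lambda>p. tuple_dom (ty p)) (pred_transformer \<delta> \<Phi>)
      (modular_encoding pr \<tau> \<rho> \<Delta>BV \<Delta>IA)"
proof -
  interpret modular_chcs w ty pr d0 m0 \<Phi> \<delta> \<rho> \<tau> \<Delta>BV \<Delta>IA
  proof
    show "\<Phi> = \<Delta>BV \<union> \<Delta>IA"
      using assms(4,5) by blast
  qed (fact assms)+
  show ?thesis
    by (rule satisfiable_iff)
qed

end
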